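(* Let $A\in\mathbb{R}^{m\times n}$, $b\in\mathbb{R}^m$, $G\in\mathbb{R}^{n\times n}$. Suppose that the polyhedron $P=\{x\in\mathbb{R}^n\mid Ax\le b\}$ is bounded, $\rho(G)<1$, and $E\subseteq P$ is invariant with respect to $G$ and contains the origin in its interior. If, for some integer $r\ge 0$, $I_r(E)=I_{r+1}(E)$, then $\mathcal{S}=I_r(E)$.
   Context: Inequalities between vectors are entrywise. $\rho(G)$ is the spectral radius of $G$. A set $E\subseteq\mathbb{R}^n$ is invariant with respect to $G$ if $x\in E$ implies $Gx\in E$. Define $\mathcal{S}:=\bigcap_{k=0}^{\infty}\{x\in\mathbb{R}^n \mid AG^kx\le b\}$, $S_r:=\bigcap_{k=0}^{r}\{x\in\mathbb{R}^n \mid AG^kx\le b\}$ for integers $r\ge0$, $S_{-1}:=\mathbb{R}^n$, and, for integers $r\ge 0$, $I_r(E):=S_{r-1}\cap\{x\in\mathbb{R}^n\mid G^rx\in E\}$ (so $I_0(E)=E$). *)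

theory Defs
  imports "HOL-Analysis.Analysis"
begin

(* The instance (^) on type vec is the entrywise power, hence a separate matrix power. *)
primrec mat_pow :: "real^'n^'n \<Rightarrow> nat \<Rightarrow> real^'n^'n" where
  "mat_pow G 0 = mat 1"
| "mat_pow G (Suc k) = G ** mat_pow G k"

definition complex_eigenvalue :: "real^'n^'n \<Rightarrow> complex \<Rightarrow> bool" where
  "complex_eigenvalue G z \<longleftrightarrow>
     (\<exists>v :: complex^'n. v \<noteq> 0 \<and> map_matrix complex_of_real G *v v = z *s v)"

(* Max is taken over a finite nonempty set: the roots of the characteristic polynomial,
   whose degree CARD('n) is positive. *)
definition mat_spectral_radius :: "real^'n^'n \<Rightarrow> real" where
  "mat_spectral_radius G = Max {cmod z | z. complex_eigenvalue G z}"

definition polyhedron_of :: "real^'n^'m \<Rightarrow> real^'m \<Rightarrow> (real^'n) set" where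
  "polyhedron_of A b = {x. A *v x \<le> b}"

definition invariant_wrt :: "(real^'n) set \<Rightarrow> real^'n^'n \<Rightarrow> bool" where
  "invariant_wrt E G \<longleftrightarrow> (\<forall>x\<in>E. G *v x \<in> E)"

definition S_inf :: "real^'n^'m \<Rightarrow> real^'m \<Rightarrow> real^'n^'n \<Rightarrow> (real^'n) set" where
  "S_inf A b G = (\<Inter>k::nat. {x. A *v (mat_pow G k *v x) \<le> b})"

(* The index is an int so that r = -1 is available; the empty intersection is then UNIV. *)
definition S_fin :: "real^'n^'m \<Rightarrow> real^'m \<Rightarrow> real^'n^'n \<Rightarrow> int \<Rightarrow> (real^'n) set" where
  "S_fin A b G r = (\<Inter>k\<in>{k::nat. int k \<le> r}. {x. A *v (mat_pow G k *v x) \<le> b})"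

definition I_set ::
  "real^'n^'m \<Rightarrow> real^'m \<Rightarrow> real^'n^'n \<Rightarrow> nat \<Rightarrow> (real^'n) set \<Rightarrow> (real^'n) set" where
  "I_set A b G r E = S_fin A b G (int r - 1) \<inter> {x. mat_pow G r *v x \<in> E}"

lemma S_fin_minus_one: "S_fin A b G (- 1) = UNIV"
  by (simp add: S_fin_def)

lemma I_set_0: "I_set A b G 0 E = E"
  by (simp add: I_set_def S_fin_minus_one)

end

theory Submission
  imports Defs "HOL-Computational_Algebra.Fundamental_Theorem_Algebra"
begin

text \<open>
  Two independent facts carry the proof.

  Dynamics: a point lies in the \<open>(k+1)\<close>-st set of the family exactly when it lies in the polyhedron
  and \<open>G\<close> sends it into the \<open>k\<close>-th set (\<open>I_set_Suc\<close>). Each set is thus obtained from its predecessor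
  by one fixed operation, so that one repetition makes the family constant from there on
  (\<open>I_set_stationary\<close>). A point of the stationary set satisfies the constraints at every time, because
  it belongs to members of the family with arbitrarily large index. Conversely, the orbit of a
  point of \<open>\<S>\<close> tends to \<open>0\<close>, hence enters \<open>E\<close> at some late time; being admissible before that time,
  the point belongs to a late member of the family, which is the stationary set.

  Linear algebra: orbits tend to \<open>0\<close> when the spectral radius is below \<open>1\<close>
  (\<open>mat_pow_tendsto_zero\<close>). Instead of Jordan blocks or a characteristic polynomial, the proof
  uses any nonzero polynomial that annihilates \<open>G\<close>; one exists because the powers of \<open>G\<close> lie in a
  finite-dimensional space. Its roots include all eigenvalues, so these form a finite set and
  the maximum in the definition of the spectral radius bounds each of them. Splitting off one linear
  factor \<open>X - z\<close> at a time reduces convergence of an orbit to a scalar recursion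
  \<open>u (k+1) = z * u k + y k\<close> with \<open>|z| < 1\<close> and \<open>y\<close> tending to \<open>0\<close> (\<open>orbit_tendsto_zero\<close>).
\<close>

section \<open>A perturbed geometric recursion\<close>

text \<open>A perturbation that stays below \<open>(1 - q) * d\<close> can keep the sequence above the geometric decay
  by at most \<open>d\<close>, the fixed point of \<open>x \<mapsto> q * x + (1 - q) * d\<close>.\<close>

lemma perturbed_geometric_tendsto_zero_real:
  fixes a e :: "nat \<Rightarrow> real"
  assumes "0 \<le> q" "q < 1" "\<And>k. 0 \<le> a k"
    and rec: "\<And>k. a (Suc k) \<le> q * a k + e k"
    and e: "e \<longlonglongrightarrow> 0"
  shows "a \<longlonglongrightarrow> 0"
proof (rule LIMSEQ_I)
  fix \<epsilon> :: real assume "0 < \<epsilon>"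
  define d where "d = \<epsilon> / 2"
  have "0 < d" using \<open>0 < \<epsilon>\<close> by (simp add: d_def)
  then have "0 < (1 - q) * d" using assms by simp
  with e have "\<forall>\<^sub>F k in sequentially. e k < (1 - q) * d"
    by (rule order_tendstoD(2))
  then obtain N where N: "\<And>k. k \<ge> N \<Longrightarrow> e k < (1 - q) * d"
    by (auto simp: eventually_sequentially)
  have bound: "a (N + j) \<le> q ^ j * a N + d" for j
  proof (induction j)
    case 0
    then show ?case using \<open>0 < d\<close> by simp
  next
    case (Suc j)
    have "a (N + Suc j) \<le> q * a (N + j) + (1 - q) * d"
      using rec[of "N + j"] N[of "N + j"] by simp
    also have "\<dots> \<le> q * (q ^ j * a N + d) + (1 - q) * d"
      using mult_left_mono[OF Suc \<open>0 \<le> q\<close>] by simp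
    also have "\<dots> = q ^ Suc j * a N + d" by (simp add: algebra_simps)
    finally show ?case .
  qed
  have "(\<lambda>j. q ^ j * a N) \<longlonglongrightarrow> 0"
    using assms by (intro tendsto_mult_left_zero LIMSEQ_realpow_zero)
  then have "\<forall>\<^sub>F j in sequentially. q ^ j * a N < d"
    using \<open>0 < d\<close> by (rule order_tendstoD(2))
  then obtain J where J: "\<And>j. j \<ge> J \<Longrightarrow> q ^ j * a N < d"
    by (auto simp: eventually_sequentially)
  have "norm (a k - 0) < \<epsilon>" if "k \<ge> N + J" for k
  proof -
    have "J \<le> k - N" using that by simp
    then show ?thesis
      using bound[of "k - N"] J[of "k - N"] that assms(3)[of k] by (simp add: d_def)
  qed
  then show "\<exists>no. \<forall>k\<ge>no. norm (a k - 0) < \<epsilon>" by blast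
qed

lemma perturbed_geometric_tendsto_zero:
  fixes u :: "nat \<Rightarrow> 'a :: real_normed_div_algebra"
  assumes "norm z < 1" and "(\<lambda>k. u (Suc k) - z * u k) \<longlonglongrightarrow> 0"
  shows "u \<longlonglongrightarrow> 0"
proof -
  have "norm (u (Suc k)) \<le> norm z * norm (u k) + norm (u (Suc k) - z * u k)" for k
    using norm_triangle_ineq[of "z * u k" "u (Suc k) - z * u k"] by (simp add: norm_mult)
  from this tendsto_norm_zero[OF assms(2)] have "(\<lambda>k. norm (u k)) \<longlonglongrightarrow> 0"
    by (rule perturbed_geometric_tendsto_zero_real[OF norm_ge_zero assms(1) norm_ge_zero])
  then show ?thesis by (rule tendsto_norm_zero_cancel)
qed

section \<open>Polynomials acting on vectors through a matrix\<close>

text \<open>The vector \<open>p(M) v\<close>. Horner's scheme avoids powers of \<open>M\<close>, and its recursion along \<open>pCons\<close>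
  matches induction on polynomials.\<close>

definition poly_act :: "'a::field^'n^'n \<Rightarrow> 'a poly \<Rightarrow> 'a^'n \<Rightarrow> 'a^'n" where
  "poly_act M p v = fold_coeffs (\<lambda>a w. a *s v + M *v w) p 0"

lemma poly_act_0 [simp]: "poly_act M 0 v = 0"
  by (simp add: poly_act_def)

lemma poly_act_pCons [simp]: "poly_act M (pCons a p) v = a *s v + M *v poly_act M p v"
  by (cases "p = 0 \<and> a = 0") (auto simp: poly_act_def)

lemma poly_act_add: "poly_act M (p + q) v = poly_act M p v + poly_act M q v"
  by (induction p q rule: poly_induct2)
    (simp_all add: matrix_vector_right_distrib)

lemma poly_act_sum: "poly_act M (sum f I) v = (\<Sum>i\<in>I. poly_act M (f i) v)"
  by (induction I rule: infinite_finite_induct) (simp_all add: poly_act_add)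

lemma poly_act_smult: "poly_act M (smult c p) v = c *s poly_act M p v"
  by (induction p)
    (simp_all add: vector_scalar_commute)

lemma poly_act_monom: "poly_act M (monom c i) v = c *s (((*v) M) ^^ i) v"
  by (induction i) (simp_all add: monom_0 monom_Suc vector_scalar_commute)

lemma poly_act_diff_right: "poly_act M p (v - w) = poly_act M p v - poly_act M p w"
  by (induction p)
    (simp_all add: matrix_vector_mult_diff_distrib)

lemma poly_act_scale_right: "poly_act M p (c *s v) = c *s poly_act M p v"
  by (induction p)
    (simp_all add: vector_scalar_commute mult.commute)

lemma poly_act_commute: "poly_act M p (M *v v) = M *v poly_act M p v"
  by (induction p) (simp_all add: matrix_vector_right_distrib vector_scalar_commute)

lemma poly_act_linear_factor:
  "poly_act M ([:-z, 1:] * p) v = M *v poly_act M p v - z *s poly_act M p v"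
  by (simp add: poly_act_add poly_act_smult del: smult_minus_left)

lemma poly_act_eigenvector:
  assumes "M *v v = z *s v"
  shows "poly_act M p v = poly p z *s v"
  by (induction p)
    (simp_all add: assms vector_scalar_commute mult.commute)

section \<open>Orbits of a matrix without large eigenvalues\<close>

text \<open>Write \<open>p = (X - z) q\<close> with a root \<open>z\<close> of \<open>p\<close>. If \<open>z\<close> is not an eigenvalue, \<open>M - z\<close> is injective
  and the factor can be cancelled. Otherwise \<open>q\<close> annihilates \<open>M v - z v\<close>, whose orbit tends to \<open>0\<close> by
  induction; that orbit is the perturbation in the geometric recursion for the orbit of \<open>v\<close>.\<close>

lemma orbit_tendsto_zero:
  fixes M :: "complex^'n^'n"
  assumes ev: "\<And>z v. v \<noteq> 0 \<Longrightarrow> M *v v = z *s v \<Longrightarrow> cmod z < 1"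
    and "p \<noteq> 0" and "poly_act M p v = 0"
  shows "(\<lambda>k. (((*v) M) ^^ k) v) \<longlonglongrightarrow> 0"
  using assms(2,3)
proof (induction "degree p" arbitrary: p v)
  case 0
  then obtain c where "p = [:c:]" "c \<noteq> 0"
    by (metis degree_eq_zeroE pCons_eq_0_iff)
  with 0 have "v = 0" by simp
  moreover have "(((*v) M) ^^ k) 0 = 0" for k by (induction k) simp_all
  ultimately show ?case by simp
next
  case (Suc d)
  then have "\<not> constant (poly p)" by (simp add: constant_degree)
  then obtain z where "poly p z = 0"
    using fundamental_theorem_of_algebra by blast
  then obtain q where p: "p = [:-z, 1:] * q"
    by (auto simp: poly_eq_0_iff_dvd)
  with Suc.prems have "q \<noteq> 0" by auto
  have "degree p = Suc (degree q)"
    unfolding p using \<open>q \<noteq> 0\<close> by (subst degree_mult_eq) auto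
  with Suc.hyps have deg: "d = degree q" by simp
  have fac: "M *v poly_act M q v = z *s poly_act M q v"
    using Suc.prems by (simp only: p poly_act_linear_factor) simp
  show ?case
  proof (cases "poly_act M q v = 0")
    case True
    with deg \<open>q \<noteq> 0\<close> show ?thesis by (rule Suc.hyps(1))
  next
    case False
    then have "cmod z < 1" using fac by (rule ev)
    have "poly_act M q (M *v v - z *s v) = 0"
      using fac by (simp add: poly_act_diff_right poly_act_commute poly_act_scale_right)
    with deg \<open>q \<noteq> 0\<close> have lim: "(\<lambda>k. (((*v) M) ^^ k) (M *v v - z *s v)) \<longlonglongrightarrow> 0"
      by (rule Suc.hyps(1))
    have shift: "(((*v) M) ^^ k) (M *v v - z *s v) = (((*v) M) ^^ Suc k) v - z *s (((*v) M) ^^ k) v"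
      for k
      by (induction k) (simp_all add: matrix_vector_mult_diff_distrib vector_scalar_commute)
    show ?thesis
    proof (rule vec_tendstoI)
      fix i
      define u where "u k = ((((*v) M) ^^ k) v) $ i" for k
      have "(\<lambda>k. ((((*v) M) ^^ Suc k) v) $ i - z * ((((*v) M) ^^ k) v) $ i) \<longlonglongrightarrow> 0"
        using tendsto_vec_nth[OF lim, of i]
        by (simp only: shift vector_minus_component vector_smult_component zero_index)
      then have "(\<lambda>k. u (Suc k) - z * u k) \<longlonglongrightarrow> 0" by (simp only: u_def)
      with \<open>cmod z < 1\<close> have "u \<longlonglongrightarrow> 0" by (rule perturbed_geometric_tendsto_zero)
      then show "(\<lambda>k. ((((*v) M) ^^ k) v) $ i) \<longlonglongrightarrow> 0 $ i"
        by (simp only: u_def[abs_def] zero_index)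
    qed
  qed
qed

section \<open>Real matrices of spectral radius below one\<close>

lemma map_matrix_of_real_mult:
  fixes A :: "real^'n^'m" and B :: "real^'p^'n"
  shows "map_matrix complex_of_real (A ** B) = map_matrix complex_of_real A ** map_matrix complex_of_real B"
  by (simp add: vec_eq_iff matrix_matrix_mult_def)

lemma map_matrix_of_real_mat_1:
  "map_matrix complex_of_real (mat 1 :: real^'n^'n) = mat 1"
  by (simp add: vec_eq_iff mat_def)

lemma orbit_map_matrix_of_real:
  "(((*v) (map_matrix complex_of_real G)) ^^ k) v = map_matrix complex_of_real (mat_pow G k) *v v"
  by (induction k)
    (simp_all add: map_matrix_of_real_mult map_matrix_of_real_mat_1 matrix_vector_mul_assoc)

text \<open>A Cayley--Hamilton substitute without control of the degree.\<close>

lemma mat_pow_linear_dependence: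
  fixes G :: "real^'n^'n"
  obtains c N j where "j \<le> N" "c j \<noteq> 0" "(\<Sum>i\<le>N. c i *\<^sub>R mat_pow G i) = 0"
proof -
  define N where "N = DIM(real^'n^'n)"
  show thesis
  proof (cases "inj_on (mat_pow G) {..N}")
    case True
    then have "DIM(real^'n^'n) < card (mat_pow G ` {..N})"
      by (simp add: card_image N_def)
    then have "dependent (mat_pow G ` {..N})"
      using dependent_biggerset by blast
    then obtain w j where "j \<le> N" "w (mat_pow G j) \<noteq> 0"
        "(\<Sum>X\<in>mat_pow G ` {..N}. w X *\<^sub>R X) = 0"
      by (auto simp: dependent_finite)
    then show thesis
      using that[of j N "\<lambda>i. w (mat_pow G i)"] by (simp add: sum.reindex[OF True])
  next
    case False
    then obtain i j where ij: "i \<le> N" "j \<le> N" "i \<noteq> j" "mat_pow G i = mat_pow G j"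
      by (auto simp: inj_on_def)
    \<comment> \<open>Linear dependence of a set ignores repeated elements, so two equal powers are not a
      dependence of the image set; their difference supplies the relation.\<close>
    define c :: "nat \<Rightarrow> real" where "c k = of_bool (k = i) - of_bool (k = j)" for k
    have "c k *\<^sub>R mat_pow G k
        = (if k = i then mat_pow G k else 0) - (if k = j then mat_pow G k else 0)" for k
      by (simp add: c_def)
    then have "(\<Sum>k\<le>N. c k *\<^sub>R mat_pow G k) = mat_pow G i - mat_pow G j"
      using ij by (simp add: sum_subtractf)
    then show thesis
      using that[of i N c] ij by (simp add: c_def)
  qed
qed

lemma annihilating_polynomial_exists:
  fixes G :: "real^'n^'n"
  obtains p where "p \<noteq> 0" "\<And>v. poly_act (map_matrix complex_of_real G) p v = 0"
proof -
  obtain c N j where c: "j \<le> N" "c j \<noteq> 0" "(\<Sum>i\<le>N. c i *\<^sub>R mat_pow G i) = 0"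
    by (rule mat_pow_linear_dependence)
  define p where "p = (\<Sum>i\<le>N. monom (complex_of_real (c i)) i)"
  have "coeff p j = complex_of_real (c j)"
    using c(1) by (simp add: p_def coeff_sum)
  with c(2) have "p \<noteq> 0" by auto
  moreover have "poly_act (map_matrix complex_of_real G) p v = 0" for v
  proof -
    have entry: "(\<Sum>i\<le>N. c i * mat_pow G i $ k $ l) = 0" for k l
      using arg_cong[OF c(3), of "\<lambda>X. X $ k $ l"] by simp
    have "poly_act (map_matrix complex_of_real G) p v $ k = 0" for k
    proof -
      have "poly_act (map_matrix complex_of_real G) p v $ k
          = (\<Sum>i\<le>N. \<Sum>l\<in>UNIV. complex_of_real (c i * mat_pow G i $ k $ l) * v $ l)"
        by (simp add: p_def poly_act_sum poly_act_monom orbit_map_matrix_of_real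
            matrix_vector_mult_def sum_distrib_left mult.assoc)
      also have "\<dots> = (\<Sum>l\<in>UNIV. complex_of_real (\<Sum>i\<le>N. c i * mat_pow G i $ k $ l) * v $ l)"
        by (subst sum.swap) (simp add: sum_distrib_right)
      finally show ?thesis by (simp add: entry)
    qed
    then show ?thesis by (simp add: vec_eq_iff)
  qed
  ultimately show thesis by (rule that)
qed

lemma finite_complex_eigenvalues: "finite {z. complex_eigenvalue G z}"
proof -
  obtain p where p: "p \<noteq> 0" "\<And>v. poly_act (map_matrix complex_of_real G) p v = 0"
    by (rule annihilating_polynomial_exists) blast
  have "poly p z = 0" if "complex_eigenvalue G z" for z
  proof -
    from that obtain v where "v \<noteq> 0" "map_matrix complex_of_real G *v v = z *s v"
      by (auto simp: complex_eigenvalue_def)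
    with p(2)[of v] show ?thesis by (simp add: poly_act_eigenvector)
  qed
  then have "{z. complex_eigenvalue G z} \<subseteq> {z. poly p z = 0}" by blast
  then show ?thesis
    using poly_roots_finite[OF p(1)] finite_subset by blast
qed

lemma complex_eigenvalue_le_spectral_radius:
  assumes "complex_eigenvalue G z"
  shows "cmod z \<le> mat_spectral_radius G"
proof -
  have "{cmod z | z. complex_eigenvalue G z} = cmod ` {z. complex_eigenvalue G z}" by auto
  then show ?thesis
    unfolding mat_spectral_radius_def using assms
    by (intro Max_ge) (auto simp: finite_complex_eigenvalues)
qed

lemma mat_pow_tendsto_zero:
  fixes G :: "real^'n^'n"
  assumes "mat_spectral_radius G < 1"
  shows "(\<lambda>k. mat_pow G k *v x) \<longlonglongrightarrow> 0"
proof (rule vec_tendstoI)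
  fix i
  let ?M = "map_matrix complex_of_real G"
  define v :: "complex^'n" where "v = (\<chi> j. complex_of_real (x $ j))"
  obtain p where "p \<noteq> 0" "\<And>v. poly_act ?M p v = 0"
    by (rule annihilating_polynomial_exists) blast
  moreover have "cmod z < 1" if "w \<noteq> 0" "?M *v w = z *s w" for z w
  proof -
    have "complex_eigenvalue G z" using that by (auto simp: complex_eigenvalue_def)
    with assms show ?thesis using complex_eigenvalue_le_spectral_radius[of G z] by simp
  qed
  ultimately have "(\<lambda>k. (((*v) ?M) ^^ k) v) \<longlonglongrightarrow> 0"
    using orbit_tendsto_zero by blast
  then have "(\<lambda>k. ((((*v) ?M) ^^ k) v) $ i) \<longlonglongrightarrow> 0"
    using tendsto_vec_nth[of _ 0] by fastforce
  moreover have "((((*v) ?M) ^^ k) v) $ i = complex_of_real ((mat_pow G k *v x) $ i)" for k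
    by (simp add: orbit_map_matrix_of_real v_def matrix_vector_mult_def)
  ultimately have "(\<lambda>k. complex_of_real ((mat_pow G k *v x) $ i)) \<longlonglongrightarrow> of_real 0"
    by simp
  then show "(\<lambda>k. (mat_pow G k *v x) $ i) \<longlonglongrightarrow> 0 $ i"
    by (simp only: tendsto_of_real_iff zero_index)
qed

section \<open>The sets of points entering a target set\<close>

lemma mat_pow_Suc_vector: "mat_pow G (Suc k) *v x = mat_pow G k *v (G *v x)"
  by (induction k) (simp_all flip: matrix_vector_mul_assoc)

lemma mem_I_set_iff:
  "x \<in> I_set A b G r E \<longleftrightarrow> (\<forall>k<r. A *v (mat_pow G k *v x) \<le> b) \<and> mat_pow G r *v x \<in> E"
  by (auto simp: I_set_def S_fin_def)

lemma I_set_Suc: "I_set A b G (Suc r) E = polyhedron_of A b \<inter> {x. G *v x \<in> I_set A b G r E}"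
proof -
  have "(\<forall>k<Suc r. A *v (mat_pow G k *v x) \<le> b) \<longleftrightarrow>
      A *v x \<le> b \<and> (\<forall>k<r. A *v (mat_pow G k *v (G *v x)) \<le> b)" for x
    by (simp only: All_less_Suc2 mat_pow_Suc_vector) simp
  then show ?thesis
    by (simp add: set_eq_iff mem_I_set_iff polyhedron_of_def mat_pow_Suc_vector del: mat_pow.simps)
qed

lemma I_set_stationary:
  assumes "I_set A b G r E = I_set A b G (Suc r) E"
  shows "I_set A b G (r + j) E = I_set A b G r E"
proof (induction j)
  case (Suc j)
  have "I_set A b G (r + Suc j) E = I_set A b G (Suc r) E"
    using Suc by (simp add: I_set_Suc)
  with assms show ?case by simp
qed simp

theorem lemma2p9:
  fixes A :: "real^'n^'m" and b :: "real^'m" and G :: "real^'n^'n"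
    and E :: "(real^'n) set" and r :: nat
  assumes "bounded (polyhedron_of A b)"
    and "mat_spectral_radius G < 1"
    and "E \<subseteq> polyhedron_of A b"
    and "invariant_wrt E G"
    and "0 \<in> interior E"
    and "I_set A b G r E = I_set A b G (r + 1) E"
  shows "S_inf A b G = I_set A b G r E"
proof
  have stat: "I_set A b G (r + j) E = I_set A b G r E" for j
    using assms(6) by (intro I_set_stationary) simp
  show "S_inf A b G \<subseteq> I_set A b G r E"
  proof
    fix x assume x: "x \<in> S_inf A b G"
    have "\<forall>\<^sub>F k in sequentially. mat_pow G k *v x \<in> interior E"
      using mat_pow_tendsto_zero[OF assms(2)] open_interior assms(5) by (rule topological_tendstoD)
    then obtain K where K: "\<And>k. k \<ge> K \<Longrightarrow> mat_pow G k *v x \<in> interior E"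
      by (auto simp: eventually_sequentially)
    have "mat_pow G (r + K) *v x \<in> E"
      using K[of "r + K"] interior_subset by auto
    with x have "x \<in> I_set A b G (r + K) E"
      by (simp add: mem_I_set_iff S_inf_def)
    then show "x \<in> I_set A b G r E" by (simp only: stat)
  qed
  show "I_set A b G r E \<subseteq> S_inf A b G"
  proof
    fix x assume x: "x \<in> I_set A b G r E"
    have "A *v (mat_pow G k *v x) \<le> b" for k
    proof -
      have "x \<in> I_set A b G (r + Suc k) E" using x by (simp only: stat)
      then show ?thesis by (simp add: mem_I_set_iff)
    qed
    then show "x \<in> S_inf A b G" by (simp add: S_inf_def)
  qed
qed

end
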